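(* For every finite lattice $L=(L,\le)$, the c-rank of $L$ equals its height: $\operatorname{c-rk}(L)=\operatorname{ht}(L)$.
   Context: The superboolean semiring is $\mathbb{SB}=\{0,1,1^\nu\}$ with commutative operations: $0+x=x$ for all $x$, $1+1=1+1^\nu=1^\nu+1^\nu=1^\nu$; $0\cdot x=0$, $1\cdot x=x$, $1^\nu\cdot 1^\nu=1^\nu$. Vectors $v_1,\dots,v_m\in\mathbb{SB}^{n}$ are dependent if there are $\alpha_1,\dots,\alpha_m\in\{0,1\}$, not all $0$, with $\alpha_1v_1+\cdots+\alpha_mv_m\in\{0,1^\nu\}^{n}$; otherwise they are independent. The rank of a matrix over $\mathbb{SB}$ is the maximal number of independent columns. For a finite poset $(P,\le)$, let $A(P)$ be the matrix with rows and columns indexed by $P$, with entry $a_{p,q}=1$ if $p\le q$ and $a_{p,q}=0$ otherwise, and let $A(P)^{c}$ be its complement (interchange the entries $0$ and $1$), regarded as a matrix over $\mathbb{SB}$. The c-rank of $P$ is $\operatorname{c-rk}(P):=\operatorname{rank}(A(P)^{c})$. The height $\operatorname{ht}(P)$ is the largest $k$ such that there is a strict chain $p_0<p_1<\cdots<p_k$ in $P$. *)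

theory Defs
  imports "HOL-Analysis.Finite_Cartesian_Product"
begin

text \<open>The superboolean semiring; \<open>Ghost\<close> is the element $1^\nu$.\<close>

datatype sb = Zero | One | Ghost

instantiation sb :: comm_semiring_1
begin

definition zero_sb :: sb where "0 = Zero"
definition one_sb :: sb where "1 = One"

fun plus_sb :: "sb \<Rightarrow> sb \<Rightarrow> sb" where
  "Zero + x = x"
| "x + Zero = x"
| "_ + _ = Ghost"

fun times_sb :: "sb \<Rightarrow> sb \<Rightarrow> sb" where
  "Zero * _ = Zero"
| "_ * Zero = Zero"
| "One * x = x"
| "x * One = x"
| "Ghost * Ghost = Ghost"

instance
proof
  fix a b c :: sb
  show "a + b + c = a + (b + c)" by (cases a; cases b; cases c) simp_all
  show "a + b = b + a" by (cases a; cases b) simp_all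
  show "0 + a = a" by (simp add: zero_sb_def)
  show "a * b * c = a * (b * c)" by (cases a; cases b; cases c) simp_all
  show "a * b = b * a" by (cases a; cases b) simp_all
  show "1 * a = a" by (cases a) (simp_all add: one_sb_def)
  show "(a + b) * c = a * c + b * c" by (cases a; cases b; cases c) simp_all
  show "0 * a = 0" by (simp add: zero_sb_def)
  show "a * 0 = 0" by (cases a) (simp_all add: zero_sb_def)
  show "(0::sb) \<noteq> 1" by (simp add: zero_sb_def one_sb_def)
qed

end

text \<open>Dependence of a family of vectors with a finite index set \<open>K\<close>. It is a notion for families,
  not for sets of vectors: a vector listed twice is dependent. The coefficients range over
  \<open>{0, 1}\<close> only, while the sum is taken in the semiring.\<close>

definition sb_dependent :: "'k set \<Rightarrow> ('k \<Rightarrow> sb ^ 'n) \<Rightarrow> bool" where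
  "sb_dependent K v \<longleftrightarrow>
    (\<exists>\<alpha> :: 'k \<Rightarrow> sb. (\<forall>k\<in>K. \<alpha> k \<in> {0, 1}) \<and> (\<exists>k\<in>K. \<alpha> k \<noteq> 0) \<and>
      (\<forall>i. (\<Sum>k\<in>K. \<alpha> k *s v k) $ i \<in> {0, Ghost}))"

abbreviation sb_independent :: "'k set \<Rightarrow> ('k \<Rightarrow> sb ^ 'n) \<Rightarrow> bool" where
  "sb_independent K v \<equiv> \<not> sb_dependent K v"

definition sb_rank :: "sb ^ 'n ^ 'm \<Rightarrow> nat" where
  "sb_rank M = Max {card J | J. sb_independent J (\<lambda>j. column j M)}"

definition order_matrix :: "sb ^ 'a::{finite, order} ^ 'a::{finite, order}" where
  "order_matrix = (\<chi> p q. if p \<le> q then 1 else 0)"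

definition matrix_complement :: "sb ^ 'n ^ 'm \<Rightarrow> sb ^ 'n ^ 'm" where
  "matrix_complement M =
    (\<chi> i j. if M $ i $ j = 0 then 1 else if M $ i $ j = 1 then 0 else M $ i $ j)"

text \<open>A finite poset is given by its type, passed as \<open>TYPE('a)\<close>.\<close>

definition c_rank :: "'a::{finite, order} itself \<Rightarrow> nat" where
  "c_rank _ = sb_rank (matrix_complement (order_matrix :: sb ^ 'a::_ ^ 'a::_))"

definition height :: "'a::{finite, order} itself \<Rightarrow> nat" where
  "height _ = Max {k. \<exists>p :: nat \<Rightarrow> 'a. \<forall>i<k. p i < p (Suc i)}"

text \<open>Both maxima are taken over finite nonempty sets.\<close>

lemma sb_rank_set:
  fixes M :: "sb ^ 'n ^ 'm"
  defines "S \<equiv> {card J | J. sb_independent J (\<lambda>j. column j M)}"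
  shows "finite S" and "0 \<in> S"
proof -
  show "finite S" unfolding S_def by simp
  have "sb_independent ({} :: 'n set) (\<lambda>j. column j M)"
    by (simp add: sb_dependent_def)
  then show "0 \<in> S" unfolding S_def by (metis (mono_tags, lifting) card.empty mem_Collect_eq)
qed

lemma height_set:
  defines "S \<equiv> {k. \<exists>p :: nat \<Rightarrow> 'a::{finite, order}. \<forall>i<k. p i < p (Suc i)}"
  shows "finite S" and "0 \<in> S"
proof -
  have "k \<le> CARD('a)" if "\<forall>i<k. p i < p (Suc i)" for k and p :: "nat \<Rightarrow> 'a"
  proof -
    have less: "j \<le> k \<longrightarrow> i < j \<longrightarrow> p i < p j" for i j
    proof (induction j)
      case (Suc j)
      show ?case
      proof (intro impI)
        assume "Suc j \<le> k" "i < Suc j"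
        then have "p j < p (Suc j)" using that by simp
        moreover have "p i \<le> p j"
          using Suc \<open>Suc j \<le> k\<close> \<open>i < Suc j\<close> by (cases "i = j") (auto intro: less_imp_le)
        ultimately show "p i < p (Suc j)" by simp
      qed
    qed simp
    have "inj_on p {..k}"
      by (rule inj_onI) (metis less atMost_iff less_irrefl linorder_neqE_nat)
    then have "card {..k} \<le> CARD('a)"
      by (rule card_inj_on_le) simp_all
    then show ?thesis by simp
  qed
  then have "S \<subseteq> {..CARD('a)}" unfolding S_def by auto
  then show "finite S" by (rule finite_subset) simp
  show "0 \<in> S" unfolding S_def by simp
qed

end

theory Submission
  imports Defs
begin

text \<open>
  The column of \<open>A(L)\<^sup>c\<close> at \<open>q\<close> has a \<open>1\<close> in row \<open>x\<close> exactly if \<open>x\<close> does not lie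
  below \<open>q\<close>. A sum of zeros and ones in the superboolean semiring equals \<open>1\<close> only if exactly one
  summand is \<open>1\<close>. Hence a set \<open>J\<close> of columns is independent iff every nonempty \<open>K \<subseteq> J\<close> has a
  ``witness'': an \<open>x\<close> that lies below all elements of \<open>K\<close> except precisely one
  (\<open>independent_iff_unique_non_upper_bound\<close>). The sizes of independent sets of columns are then the
  lengths of strict chains.

  From chains to columns (\<open>independent_chain\<close>): for \<open>p\<^sub>0 < \<dots> < p\<^sub>k\<close> take
  \<open>J = {p\<^sub>0, \<dots>, p\<^bsub>k-1\<^esub>}\<close>. If \<open>p\<^sub>i\<close> is the least element of \<open>K \<subseteq> J\<close>, then \<open>p\<^bsub>i+1\<^esub>\<close> lies below
  all elements of \<open>K\<close> but \<open>p\<^sub>i\<close>.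

  From columns to chains (\<open>chain_from_independent\<close>): let \<open>x\<close> be a witness for \<open>J\<close> and \<open>k\<close> the
  exceptional element. Then \<open>x\<close> lies below the meet of \<open>J - {k}\<close> but not below the meet of \<open>J\<close>, so
  that these two meets differ. Removing exceptional elements one after another therefore makes the
  meet grow strictly, from the meet of \<open>J\<close> to the meet of the empty set, which is the top element;
  this is a strict chain with \<open>card J\<close> steps.
\<close>

section \<open>Independence of zero-one vectors\<close>

lemma of_nat_sb: "(of_nat n :: sb) = (if n = 0 then Zero else if n = 1 then One else Ghost)"
proof (induction n)
  case (Suc n)
  then show ?case by (cases "n = 0"; cases "n = 1") (simp_all add: one_sb_def zero_sb_def)
qed (simp add: zero_sb_def)

lemma of_nat_sb_nontangible_iff: "(of_nat n :: sb) \<in> {0, Ghost} \<longleftrightarrow> n \<noteq> 1"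
  unfolding of_nat_sb by (simp add: zero_sb_def)

lemma sum_indicator_sb_nontangible_iff:
  assumes "finite J"
  shows "(\<Sum>k\<in>J. if P k then 1 else 0 :: sb) \<in> {0, Ghost} \<longleftrightarrow> \<not> (\<exists>!k. k \<in> J \<and> P k)"
proof -
  have "(\<Sum>k\<in>J. if P k then 1 else 0 :: sb) = of_nat (card {k \<in> J. P k})"
    using assms by (simp add: sum.If_cases Int_def)
  moreover have "card {k \<in> J. P k} = 1 \<longleftrightarrow> (\<exists>!k. k \<in> J \<and> P k)"
    unfolding card_1_singleton_iff One_nat_def set_eq_iff by (simp, metis)
  ultimately show ?thesis by (simp only: of_nat_sb_nontangible_iff)
qed

text \<open>Coefficients in \<open>{0, 1}\<close> amount to the choice of a subset, the support of \<open>\<alpha>\<close>; a coordinate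
  of the sum over this subset is \<open>1\<close> iff exactly one chosen vector has a \<open>1\<close> there.\<close>

lemma sb_independent_zero_one_iff:
  fixes v :: "'k \<Rightarrow> sb ^ 'n"
  assumes "finite J" and v: "\<And>k i. v k $ i = (if R i k then 1 else 0)"
  shows "sb_independent J v \<longleftrightarrow> (\<forall>K\<subseteq>J. K \<noteq> {} \<longrightarrow> (\<exists>i. \<exists>!k. k \<in> K \<and> R i k))"
proof -
  have coord: "(\<Sum>k\<in>J. \<alpha> k *s v k) $ i \<in> {0, Ghost} \<longleftrightarrow> \<not> (\<exists>!k. k \<in> J \<and> \<alpha> k \<noteq> 0 \<and> R i k)"
    if "\<forall>k\<in>J. \<alpha> k \<in> {0, 1}" for \<alpha> :: "'k \<Rightarrow> sb" and i
  proof -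
    have "(\<Sum>k\<in>J. \<alpha> k *s v k) $ i = (\<Sum>k\<in>J. if \<alpha> k \<noteq> 0 \<and> R i k then 1 else 0)"
      using that by (auto simp: v intro!: sum.cong)
    then show ?thesis by (simp only: sum_indicator_sb_nontangible_iff[OF \<open>finite J\<close>])
  qed
  have "sb_dependent J v \<longleftrightarrow> (\<exists>K\<subseteq>J. K \<noteq> {} \<and> (\<forall>i. \<not> (\<exists>!k. k \<in> K \<and> R i k)))"
  proof
    assume "sb_dependent J v"
    then obtain \<alpha> where \<alpha>: "\<forall>k\<in>J. \<alpha> k \<in> {0, 1}" "\<exists>k\<in>J. \<alpha> k \<noteq> 0"
      "\<forall>i. (\<Sum>k\<in>J. \<alpha> k *s v k) $ i \<in> {0, Ghost}"
      unfolding sb_dependent_def by blast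
    then have "\<forall>i. \<not> (\<exists>!k. k \<in> J \<and> \<alpha> k \<noteq> 0 \<and> R i k)" by (simp only: coord) simp
    then have "\<forall>i. \<not> (\<exists>!k. k \<in> {k \<in> J. \<alpha> k \<noteq> 0} \<and> R i k)"
      by (simp only: mem_Collect_eq conj_assoc) simp
    moreover have "{k \<in> J. \<alpha> k \<noteq> 0} \<subseteq> J" "{k \<in> J. \<alpha> k \<noteq> 0} \<noteq> {}" using \<alpha>(2) by auto
    ultimately show "\<exists>K\<subseteq>J. K \<noteq> {} \<and> (\<forall>i. \<not> (\<exists>!k. k \<in> K \<and> R i k))"
      by (intro exI conjI)
  next
    assume "\<exists>K\<subseteq>J. K \<noteq> {} \<and> (\<forall>i. \<not> (\<exists>!k. k \<in> K \<and> R i k))"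
    then obtain K where K: "K \<subseteq> J" "K \<noteq> {}" "\<forall>i. \<not> (\<exists>!k. k \<in> K \<and> R i k)" by blast
    define \<alpha> :: "'k \<Rightarrow> sb" where "\<alpha> k = (if k \<in> K then 1 else 0)" for k
    have supp: "k \<in> J \<and> \<alpha> k \<noteq> 0 \<and> Q \<longleftrightarrow> k \<in> K \<and> Q" for k Q
      using K(1) by (auto simp: \<alpha>_def)
    have 01: "\<forall>k\<in>J. \<alpha> k \<in> {0, 1}" by (simp add: \<alpha>_def)
    have "\<exists>k\<in>J. \<alpha> k \<noteq> 0" using K(1,2) by (auto simp: \<alpha>_def)
    moreover have "\<forall>i. (\<Sum>k\<in>J. \<alpha> k *s v k) $ i \<in> {0, Ghost}"
      unfolding coord[OF 01] supp by (rule K(3))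
    ultimately show "sb_dependent J v" unfolding sb_dependent_def using 01 by blast
  qed
  then show ?thesis by (simp only: not_ex not_all de_Morgan_conj not_not imp_conv_disj)
qed

section \<open>Independent columns and chains\<close>

abbreviation c_column :: "'a::{finite, order} \<Rightarrow> sb ^ 'a::_" where
  "c_column q \<equiv> column q (matrix_complement order_matrix)"

lemma c_column_nth: "c_column q $ x = (if \<not> x \<le> q then 1 else 0)"
  by (simp add: column_def matrix_complement_def order_matrix_def)

lemma independent_iff_unique_non_upper_bound:
  fixes J :: "'a::{finite, order} set"
  shows "sb_independent J c_column \<longleftrightarrow>
    (\<forall>K\<subseteq>J. K \<noteq> {} \<longrightarrow> (\<exists>x. \<exists>!k. k \<in> K \<and> \<not> x \<le> k))"
  by (rule sb_independent_zero_one_iff) (simp_all add: c_column_nth)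

lemma chain_less:
  fixes p :: "nat \<Rightarrow> 'a::order"
  assumes chain: "\<forall>i<n. p i < p (Suc i)" and "i < j" "j \<le> n"
  shows "p i < p j"
  using \<open>i < j\<close> \<open>j \<le> n\<close>
proof (induction j rule: less_Suc_induct)
  case (1 i)
  then show ?case using chain by simp
next
  case (2 i j k)
  then show ?case by (meson less_imp_le order.trans order.strict_trans)
qed

text \<open>The top element of the chain is not among the chosen columns; it serves only as the witness
  row of its predecessor.\<close>

lemma independent_chain:
  fixes p :: "nat \<Rightarrow> 'a::{finite, order}"
  assumes chain: "\<forall>i<n. p i < p (Suc i)"
  shows "sb_independent (p ` {..<n}) c_column" and "card (p ` {..<n}) = n"
proof -
  show "sb_independent (p ` {..<n}) c_column"
    unfolding independent_iff_unique_non_upper_bound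
  proof (intro allI impI)
    fix K assume K: "K \<subseteq> p ` {..<n}" "K \<noteq> {}"
    define i where "i = (LEAST i. i < n \<and> p i \<in> K)"
    have "\<exists>i. i < n \<and> p i \<in> K" using K by blast
    then have i: "i < n" "p i \<in> K" unfolding i_def by (metis (mono_tags, lifting) LeastI_ex)+
    have "\<not> p (Suc i) \<le> p i" using chain i(1) by (simp add: less_le_not_le)
    moreover have "k = p i" if "k \<in> K" "\<not> p (Suc i) \<le> k" for k
    proof -
      obtain j where j: "k = p j" "j < n" using K(1) \<open>k \<in> K\<close> by blast
      then have "i \<le> j" unfolding i_def using \<open>k \<in> K\<close> by (auto intro: Least_le)
      moreover have "\<not> Suc i < j"
        using chain_less[OF chain, of "Suc i" j] j that(2) by (auto simp: less_imp_le)
      moreover have "j \<noteq> Suc i" using j(1) that(2) by auto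
      ultimately have "j = i" by simp
      then show ?thesis using j(1) by simp
    qed
    ultimately show "\<exists>x. \<exists>!k. k \<in> K \<and> \<not> x \<le> k" using i(2) by blast
  qed
  have "inj_on p {..<n}"
  proof (rule linorder_inj_onI')
    show "p i \<noteq> p j" if "i \<in> {..<n}" "j \<in> {..<n}" "i < j" for i j
      using chain_less[OF chain that(3)] that(2) by auto
  qed
  then show "card (p ` {..<n}) = n" by (simp add: card_image)
qed

text \<open>The induction removes the exceptional element of \<open>J\<close> and needs to know where the chain
  for the smaller set starts. The second conjunct says that it starts at the meet of the
  set, written as a universal property so that the empty set, with the top element as its meet, is
  covered too.\<close>

lemma chain_from_independent:
  fixes J :: "'a::{finite, lattice} set"
  assumes "sb_independent J c_column"
  shows "\<exists>p :: nat \<Rightarrow> 'a. (\<forall>i<card J. p i < p (Suc i)) \<and> (\<forall>x. x \<le> p 0 \<longleftrightarrow> (\<forall>k\<in>J. x \<le> k))"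
  using assms
proof (induction "card J" arbitrary: J)
  case 0
  have "\<forall>x. x \<le> Sup_fin (UNIV :: 'a set)" by (simp add: Sup_fin.coboundedI)
  moreover have "J = {}" using 0 by simp
  ultimately show ?case by (intro exI[of _ "\<lambda>_. Sup_fin UNIV"]) simp
next
  case (Suc n)
  have witnesses: "\<forall>K\<subseteq>J. K \<noteq> {} \<longrightarrow> (\<exists>x. \<exists>!k. k \<in> K \<and> \<not> x \<le> k)"
    using Suc.prems by (simp only: independent_iff_unique_non_upper_bound)
  have "J \<noteq> {}" using Suc.hyps(2) by auto
  then obtain x where "\<exists>!k. k \<in> J \<and> \<not> x \<le> k" using witnesses by (meson order_refl)
  then obtain k where x: "k \<in> J" "\<not> x \<le> k" "\<forall>k'\<in>J - {k}. x \<le> k'" by auto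
  have card: "card (J - {k}) = n" using Suc.hyps(2) x(1) by simp
  have "sb_independent (J - {k}) c_column"
    unfolding independent_iff_unique_non_upper_bound using witnesses by (meson Diff_subset order_trans)
  then obtain p where p: "\<forall>i<n. p i < p (Suc i)" "\<forall>y. y \<le> p 0 \<longleftrightarrow> (\<forall>k'\<in>J - {k}. y \<le> k')"
    using Suc.hyps(1)[of "J - {k}"] card by auto
  have "inf k (p 0) \<noteq> p 0" using p(2) x(2,3) by (metis inf.cobounded1 order.trans)
  then have start: "inf k (p 0) < p 0" by (simp add: order.strict_iff_order)
  define q where "q i = (case i of 0 \<Rightarrow> inf k (p 0) | Suc j \<Rightarrow> p j)" for i
  have "q i < q (Suc i)" if "i < card J" for i
    using that start p(1) Suc.hyps(2) by (cases i) (simp_all add: q_def)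
  moreover have "y \<le> q 0 \<longleftrightarrow> (\<forall>k\<in>J. y \<le> k)" for y
    using p(2) x(1) by (auto simp: q_def)
  ultimately show ?case by blast
qed

text \<open>The two maxima agree because they are taken over the same set of numbers.\<close>

theorem theorem4p5:
  shows "c_rank TYPE('a::{finite, lattice}) = height TYPE('a)"
proof -
  have "(\<exists>J :: 'a set. k = card J \<and> sb_independent J c_column) \<longleftrightarrow>
    (\<exists>p :: nat \<Rightarrow> 'a. \<forall>i<k. p i < p (Suc i))" for k
  proof
    assume "\<exists>J :: 'a set. k = card J \<and> sb_independent J c_column"
    then obtain J :: "'a set" where J: "k = card J" "sb_independent J c_column" by (elim exE conjE)
    show "\<exists>p :: nat \<Rightarrow> 'a. \<forall>i<k. p i < p (Suc i)"
      using chain_from_independent[OF J(2)] unfolding J(1) by auto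
  next
    assume "\<exists>p :: nat \<Rightarrow> 'a. \<forall>i<k. p i < p (Suc i)"
    then obtain p :: "nat \<Rightarrow> 'a" where chain: "\<forall>i<k. p i < p (Suc i)" by (elim exE)
    show "\<exists>J :: 'a set. k = card J \<and> sb_independent J c_column"
      using independent_chain[OF chain] by (intro exI[of _ "p ` {..<k}"]) simp
  qed
  then show ?thesis by (simp add: c_rank_def sb_rank_def height_def)
qed

end
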